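(* Let $T$ be a triangle with angles $(\alpha,\beta,\pi/3)$, where $\beta$ is not a rational multiple of $\pi/3$. Suppose $T$ can be used to $N$-tile some equilateral triangle and also to $K$-tile some (possibly different) equilateral triangle. Then $N$ and $K$ have the same squarefree part.
   Context: An $N$-tiling of a triangle $ABC$ by a tile $T$ is a decomposition of $ABC$ into $N$ triangles, each congruent to $T$, with pairwise disjoint interiors. The squarefree part of a positive integer $n$ is the unique squarefree $s$ with $n = s m^2$ for some integer $m$. *)

theory Defs
  imports "HOL-Analysis.Analysis" "HOL-Computational_Algebra.Squarefree"
begin

(* Interior angle at the middle argument B, in radians in {0..pi}; meaningful for A, C distinct from B. *)
definition angle_at :: "real^2 \<Rightarrow> real^2 \<Rightarrow> real^2 \<Rightarrow> real" where
  "angle_at A B C = arccos (((A - B) \<bullet> (C - B)) / (norm (A - B) * norm (C - B)))"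

(* Triangles are closed nondegenerate regions of the plane; non-collinearity also forces
   the three vertices to be distinct. *)
definition triangle_with_angles :: "(real^2) set \<Rightarrow> real \<Rightarrow> real \<Rightarrow> real \<Rightarrow> bool" where
  "triangle_with_angles T \<alpha> \<beta> \<gamma> \<longleftrightarrow>
     (\<exists>A B C. \<not> collinear {A, B, C} \<and> T = convex hull {A, B, C} \<and>
        angle_at B A C = \<alpha> \<and> angle_at A B C = \<beta> \<and> angle_at A C B = \<gamma>)"

definition equilateral_triangle :: "(real^2) set \<Rightarrow> bool" where
  "equilateral_triangle E \<longleftrightarrow>
     (\<exists>A B C. \<not> collinear {A, B, C} \<and> E = convex hull {A, B, C} \<and>
        dist A B = dist B C \<and> dist B C = dist C A)"

(* Congruence by an arbitrary isometry of the plane, so reflected copies are allowed. *)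
definition congruent_regions :: "(real^2) set \<Rightarrow> (real^2) set \<Rightarrow> bool" where
  "congruent_regions S T \<longleftrightarrow>
     (\<exists>f :: real^2 \<Rightarrow> real^2. (\<forall>x y. dist (f x) (f y) = dist x y) \<and> f ` S = T)"

(* No edge-to-edge condition is imposed. *)
definition tiling_by :: "nat \<Rightarrow> (real^2) set \<Rightarrow> (real^2) set \<Rightarrow> (real^2) set set \<Rightarrow> bool" where
  "tiling_by N T E \<T> \<longleftrightarrow>
     finite \<T> \<and> card \<T> = N \<and> (\<forall>S\<in>\<T>. congruent_regions T S) \<and> \<Union>\<T> = E \<and>
     pairwise (\<lambda>S S'. interior S \<inter> interior S' = {}) \<T>"

definition can_tile :: "nat \<Rightarrow> (real^2) set \<Rightarrow> (real^2) set \<Rightarrow> bool" where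
  "can_tile N T E \<longleftrightarrow> (\<exists>\<T>. tiling_by N T E \<T>)"

end

theory Submission
  imports Defs
begin

text \<open>
  For a function \<open>\<psi>\<close> on plane vectors with \<open>\<psi> (r x) = r \<psi> x\<close> for all real \<open>r\<close>, negative \<open>r\<close>
  included, the sum of \<open>\<psi>\<close> over the counterclockwise boundary edges is additive under dissections
  into triangles, because the contributions on the two sides of any line inside the dissected
  triangle cancel.

  Let the tile have sides \<open>a, b, c\<close> opposite the angles \<open>\<alpha>, \<beta>, \<pi>/3\<close>, and let \<open>X\<close> be the side of the
  equilateral triangle.  As \<open>\<beta>\<close> is not a rational multiple of \<open>\<pi>/3\<close>, one may give every direction
  that differs from a side of the equilateral triangle by \<open>k \<beta> + m \<pi>/3\<close> the sign \<open>(-1)^m\<close>, and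
  every other direction the sign \<open>0\<close>; let \<open>\<psi>\<close> be the length times this sign.  Each tile then
  contributes \<open>0\<close> or \<open>\<plusminus>(a + b - c)\<close>, while the equilateral triangle has the sum \<open>3 X\<close>.  So
  \<open>3 X = m (a + b - c)\<close> with an integer \<open>m\<close>, and the sides \<open>X, Y\<close> of two tiled equilateral triangles
  have a rational ratio.  Comparing areas gives \<open>X\<^sup>2 = N a b\<close> and \<open>Y\<^sup>2 = K a b\<close>, hence \<open>N/K\<close> is the
  square of a rational number.
\<close>

subsection \<open>Counterclockwise triangles and lines\<close>

text \<open>This is the cross product of \<open>Q - P\<close> and \<open>x - P\<close>, twice the
  signed area of the triangle \<open>P Q x\<close>: positive for \<open>x\<close> to the left of the
  directed line from \<open>P\<close> to \<open>Q\<close>.\<close>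

definition lft :: "complex \<Rightarrow> complex \<Rightarrow> complex \<Rightarrow> real" where
  "lft P Q x = Im (cnj (Q - P) * (x - P))"

lemma lft_cyclic: "lft P Q R = lft Q R P"
  by (simp add: lft_def algebra_simps)

lemma lft_swap: "lft P Q R = - lft Q P R"
  by (simp add: lft_def algebra_simps)

lemma lft_sum: "lft A B x + lft B C x + lft C A x = lft A B C"
  by (simp add: lft_def algebra_simps)

lemma lft_barycentric:
  fixes A B C x :: complex
  shows "of_real (lft A B C) * x = lft B C x * A + lft C A x * B + lft A B x * C"
  by (simp add: lft_def complex_eq_iff algebra_simps)

lemma lft_affine:
  assumes "u + v + w = 1"
  shows "lft P Q (u *\<^sub>R A + v *\<^sub>R B + w *\<^sub>R C) = u * lft P Q A + v * lft P Q B + w * lft P Q C"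
proof -
  have w: "w = 1 - u - v" using assms by simp
  show ?thesis unfolding w by (simp add: lft_def algebra_simps)
qed

lemma lft_self [simp]: "lft P Q P = 0" "lft P Q Q = 0" "lft P P Q = 0"
  by (simp_all add: lft_def algebra_simps)

text \<open>Divided by their sum \<open>lft A B C\<close>, the three values are the barycentric
  coordinates of \<open>x\<close>, so the triangle is the intersection of three left half
  planes.\<close>

lemma ccw_hull_eq:
  assumes "lft A B C > 0"
  shows "convex hull {A, B, C} = {x. lft A B x \<ge> 0 \<and> lft B C x \<ge> 0 \<and> lft C A x \<ge> 0}"
proof -
  have pos: "lft B C A > 0" "lft C A B > 0"
    using assms lft_cyclic[of A B C] lft_cyclic[of B C A] by auto
  show ?thesis
  proof (intro equalityI subsetI)
    fix x assume "x \<in> convex hull {A, B, C}"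
    then obtain u v w where "0 \<le> u" "0 \<le> v" "0 \<le> w" "u + v + w = 1"
      and x: "x = u *\<^sub>R A + v *\<^sub>R B + w *\<^sub>R C"
      unfolding convex_hull_3 by blast
    then show "x \<in> {x. lft A B x \<ge> 0 \<and> lft B C x \<ge> 0 \<and> lft C A x \<ge> 0}"
      using assms pos by (simp add: lft_affine)
  next
    fix x assume x: "x \<in> {x. lft A B x \<ge> 0 \<and> lft B C x \<ge> 0 \<and> lft C A x \<ge> 0}"
    define o' where "o' = lft A B C"
    have "o' > 0" using assms o'_def by simp
    have "of_real o' * x = of_real o' * ((lft B C x / o') *\<^sub>R A + (lft C A x / o') *\<^sub>R B + (lft A B x / o') *\<^sub>R C)"
      using lft_barycentric[of A B C x] \<open>o' > 0\<close> by (simp add: o'_def[symmetric] scaleR_conv_of_real distrib_left)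
    then have "x = (lft B C x / o') *\<^sub>R A + (lft C A x / o') *\<^sub>R B + (lft A B x / o') *\<^sub>R C"
      using \<open>o' > 0\<close> by (metis mult_cancel_left of_real_eq_0_iff order_less_irrefl)
    moreover have "lft B C x / o' + lft C A x / o' + lft A B x / o' = 1"
      using lft_sum[of A B x C] \<open>o' > 0\<close> by (simp add: o'_def[symmetric] add_divide_distrib[symmetric] add.commute add.left_commute)
    moreover have "0 \<le> lft B C x / o'" "0 \<le> lft C A x / o'" "0 \<le> lft A B x / o'"
      using x \<open>o' > 0\<close> by auto
    ultimately show "x \<in> convex hull {A, B, C}"
      unfolding convex_hull_3 by blast
  qed
qed

lemma ccw_interior:
  assumes "lft A B C > 0" "lft A B x > 0" "lft B C x > 0" "lft C A x > 0"
  shows "x \<in> interior (convex hull {A, B, C})"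
proof -
  have c: "continuous_on UNIV (lft P Q)" for P Q
    unfolding lft_def by (intro continuous_intros)
  have o: "open {x. lft P Q x > 0}" for P Q
    by (rule open_Collect_less) (auto intro: c continuous_on_const)
  let ?S = "{x. lft A B x > 0} \<inter> {x. lft B C x > 0} \<inter> {x. lft C A x > 0}"
  have "open ?S" by (intro open_Int o)
  moreover have "?S \<subseteq> convex hull {A, B, C}"
    using assms by (auto simp: ccw_hull_eq)
  ultimately show ?thesis using assms(2-4) by (intro interiorI[of ?S]) auto
qed

text \<open>For a unit vector \<open>u\<close>, \<open>u * Complex s t\<close> is the point with coordinates \<open>(s, t)\<close> in the
  orthonormal frame of \<open>u\<close> and \<open>u\<close> turned by a right angle; \<open>d = 1\<close> and \<open>d = - 1\<close> select the two
  sides of the line of height \<open>t\<close> parallel to \<open>u\<close>.\<close>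

definition near :: "real \<Rightarrow> complex \<Rightarrow> real \<Rightarrow> complex set \<Rightarrow> real \<Rightarrow> bool" where
  "near d u t S s \<longleftrightarrow> eventually (\<lambda>\<epsilon>. u * Complex s (t + d * \<epsilon>) \<in> S) (at_right 0)"

lemma lft_frame:
  "lft P Q (u * Complex s (t + \<delta>)) = lft P Q (u * Complex s t) + \<delta> * Re (cnj (Q - P) * u)"
  by (simp add: lft_def algebra_simps)

lemma eventually_affine_pos:
  fixes a b :: real
  assumes "a > 0 \<or> (a = 0 \<and> b > 0)"
  shows "eventually (\<lambda>\<epsilon>. a + \<epsilon> * b > 0) (at_right 0)"
  using assms
proof
  assume "a > 0"
  moreover have "((\<lambda>\<epsilon>. a + \<epsilon> * b) \<longlongrightarrow> a + 0 * b) (at_right 0)"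
    by (intro tendsto_intros)
  ultimately show ?thesis using order_tendstoD(1) by fastforce
next
  assume "a = 0 \<and> b > 0"
  then show ?thesis
    using eventually_at_right_less[of "0::real"] by (auto elim!: eventually_mono)
qed

text \<open>Just to the right of \<open>0\<close>, the sign of an affine function is the
  lexicographic sign of the pair \<open>(a, b)\<close>.\<close>

lemma eventually_affine_nonneg_iff:
  fixes a b :: real
  shows "eventually (\<lambda>\<epsilon>. a + \<epsilon> * b \<ge> 0) (at_right 0) \<longleftrightarrow> a > 0 \<or> (a = 0 \<and> b \<ge> 0)"
    (is "?L \<longleftrightarrow> ?R")
proof
  assume ?R
  then show ?L
  proof (cases "a = 0 \<and> b = 0")
    case False
    then have "eventually (\<lambda>\<epsilon>. a + \<epsilon> * b > 0) (at_right 0)"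
      using \<open>?R\<close> by (intro eventually_affine_pos) auto
    then show ?thesis by (auto elim: eventually_mono)
  qed simp
next
  assume L: ?L
  show ?R
  proof (rule ccontr)
    assume "\<not> ?R"
    then have "eventually (\<lambda>\<epsilon>. - a + \<epsilon> * (- b) > 0) (at_right 0)"
      by (intro eventually_affine_pos) auto
    with L have "eventually (\<lambda>\<epsilon>::real. False) (at_right 0)"
      by eventually_elim auto
    then show False by simp
  qed
qed

text \<open>Across the line the edge function is affine by \<open>lft_frame\<close>, so this
  lexicographic condition decides whether points slightly off the line, on the side
  \<open>d\<close>, lie in the closed left half plane of the edge.\<close>

definition ahead :: "real \<Rightarrow> complex \<Rightarrow> real \<Rightarrow> real \<Rightarrow> complex \<Rightarrow> complex \<Rightarrow> bool" where
  "ahead d u t s P Q \<longleftrightarrow> lft P Q (u * Complex s t) > 0 \<or>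
     (lft P Q (u * Complex s t) = 0 \<and> d * Re (cnj (Q - P) * u) \<ge> 0)"

lemma ahead_iff_eventually:
  "ahead d u t s P Q \<longleftrightarrow> eventually (\<lambda>\<epsilon>. lft P Q (u * Complex s (t + d * \<epsilon>)) \<ge> 0) (at_right 0)"
  unfolding lft_frame ahead_def
  by (subst eventually_affine_nonneg_iff[symmetric]) (simp add: mult_ac)

lemma near_iff_ahead:
  assumes "lft A B C > 0"
  shows "near d u t (convex hull {A, B, C}) s \<longleftrightarrow>
    ahead d u t s A B \<and> ahead d u t s B C \<and> ahead d u t s C A"
  by (simp add: near_def ccw_hull_eq[OF assms] ahead_iff_eventually eventually_conj_iff)

text \<open>Negating an eventual statement only yields outside points arbitrarily close to the line;
  here an affine function of fixed sign keeps all sufficiently close points outside.\<close>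

lemma not_near_eventually:
  assumes "lft A B C > 0" "\<not> near d u t (convex hull {A, B, C}) s"
  shows "eventually (\<lambda>\<epsilon>. u * Complex s (t + d * \<epsilon>) \<notin> convex hull {A, B, C}) (at_right 0)"
proof -
  have *: "eventually (\<lambda>\<epsilon>. u * Complex s (t + d * \<epsilon>) \<notin> convex hull {A, B, C}) (at_right 0)"
    if "\<not> ahead d u t s P Q" "(P, Q) \<in> {(A, B), (B, C), (C, A)}" for P Q
  proof -
    have "eventually (\<lambda>\<epsilon>. - lft P Q (u * Complex s t) + \<epsilon> * (- (d * Re (cnj (Q - P) * u))) > 0) (at_right 0)"
      using that(1) by (intro eventually_affine_pos) (auto simp: ahead_def)
    then show ?thesis
    proof eventually_elim
      case (elim \<epsilon>)
      have "lft P Q (u * Complex s (t + d * \<epsilon>)) =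
          - (- lft P Q (u * Complex s t) + \<epsilon> * (- (d * Re (cnj (Q - P) * u))))"
        by (simp only: lft_frame) simp
      with elim have "lft P Q (u * Complex s (t + d * \<epsilon>)) < 0" by linarith
      then show ?case using that(2) unfolding ccw_hull_eq[OF assms(1)] by auto
    qed
  qed
  then show ?thesis using assms(2) unfolding near_iff_ahead[OF assms(1)] by blast
qed

text \<open>The excluded \<open>s\<close> mark where the line of height \<open>t\<close> crosses an
  edge line not parallel to \<open>u\<close>: at most one per edge, hence negligible for the
  integrals below.\<close>

definition edge_generic :: "complex \<Rightarrow> real \<Rightarrow> real \<Rightarrow> complex \<Rightarrow> complex \<Rightarrow> bool" where
  "edge_generic u t s P Q \<longleftrightarrow> Im (cnj (Q - P) * u) = 0 \<or> lft P Q (u * Complex s t) \<noteq> 0"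

lemma finite_not_edge_generic: "finite {s. \<not> edge_generic u t s P Q}"
proof -
  define k where "k = Im (cnj (Q - P) * u)"
  define l where "l = lft P Q (u * Complex 0 t)"
  have "lft P Q (u * Complex s t) = s * k + l" for s
    by (simp add: lft_def k_def l_def algebra_simps)
  then have "{s. \<not> edge_generic u t s P Q} \<subseteq> {- l / k}"
    unfolding edge_generic_def k_def[symmetric] by (auto simp: field_simps add_eq_0_iff)
  then show ?thesis by (rule finite_subset) simp
qed

definition generic :: "complex \<Rightarrow> real \<Rightarrow> complex \<times> complex \<times> complex \<Rightarrow> real \<Rightarrow> bool" where
  "generic u t = (\<lambda>(A, B, C) s. edge_generic u t s A B \<and> edge_generic u t s B C \<and> edge_generic u t s C A)"

lemma finite_not_generic: "finite {s. \<not> generic u t p s}"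
proof (cases p)
  case (fields A B C)
  have "{s. \<not> generic u t p s} = {s. \<not> edge_generic u t s A B} \<union>
      {s. \<not> edge_generic u t s B C} \<union> {s. \<not> edge_generic u t s C A}"
    unfolding fields generic_def by auto
  then show ?thesis by (simp add: finite_not_edge_generic)
qed

lemma parallel_Re_nz:
  assumes "Im (cnj v * u) = 0" "v \<noteq> 0" "u \<noteq> 0"
  shows "Re (cnj v * u) \<noteq> 0"
  using assms by (metis complex_cnj_zero_iff complex_eq_iff mult_eq_0_iff zero_complex.sel)

text \<open>At a generic point an edge function can vanish only if the edge is parallel to
  \<open>u\<close>, and then its slope is nonzero; so the weak inequalities become strict just
  beside the line.\<close>

lemma near_interior:
  assumes "lft A B C > 0" "u \<noteq> 0" "d \<noteq> 0" "generic u t (A, B, C) s"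
    and "near d u t (convex hull {A, B, C}) s"
  shows "eventually (\<lambda>\<epsilon>. u * Complex s (t + d * \<epsilon>) \<in> interior (convex hull {A, B, C})) (at_right 0)"
proof -
  have *: "eventually (\<lambda>\<epsilon>. lft P Q (u * Complex s (t + d * \<epsilon>)) > 0) (at_right 0)"
    if "ahead d u t s P Q" "edge_generic u t s P Q" "P \<noteq> Q" for P Q
  proof -
    have "eventually (\<lambda>\<epsilon>. lft P Q (u * Complex s t) + \<epsilon> * (d * Re (cnj (Q - P) * u)) > 0) (at_right 0)"
    proof (rule eventually_affine_pos)
      have "Re (cnj (Q - P) * u) \<noteq> 0" if "lft P Q (u * Complex s t) = 0"
        using that \<open>edge_generic u t s P Q\<close> parallel_Re_nz[of "Q - P" u] \<open>P \<noteq> Q\<close> assms(2)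
        by (auto simp: edge_generic_def)
      then show "lft P Q (u * Complex s t) > 0 \<or>
          lft P Q (u * Complex s t) = 0 \<and> d * Re (cnj (Q - P) * u) > 0"
        using \<open>ahead d u t s P Q\<close> assms(3) unfolding ahead_def
        by (metis less_eq_real_def mult_eq_0_iff)
    qed
    then show ?thesis unfolding lft_frame by (simp add: mult_ac)
  qed
  have ne: "A \<noteq> B" "B \<noteq> C" "C \<noteq> A"
    using assms(1) by auto
  have "eventually (\<lambda>\<epsilon>. lft A B (u * Complex s (t + d * \<epsilon>)) > 0) (at_right 0)"
    "eventually (\<lambda>\<epsilon>. lft B C (u * Complex s (t + d * \<epsilon>)) > 0) (at_right 0)"
    "eventually (\<lambda>\<epsilon>. lft C A (u * Complex s (t + d * \<epsilon>)) > 0) (at_right 0)"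
    using assms(4,5) ne unfolding near_iff_ahead[OF assms(1)] generic_def by (auto intro!: *)
  then show ?thesis
    by eventually_elim (rule ccw_interior[OF assms(1)])
qed

section \<open>Signed edge lengths on a line as integrals\<close>

definition edge_weight :: "complex \<Rightarrow> real \<Rightarrow> complex \<Rightarrow> complex \<Rightarrow> real" where
  "edge_weight u t P Q =
     (if Im (cnj (Q - P) * u) = 0 \<and> Im (cnj u * P) = t then Re (cnj u * (Q - P)) else 0)"

text \<open>This difference of the two sides is additive over tiles at generic points, and its
  integral over \<open>s\<close> recovers the edge weights; so the overlaps between edges of
  different tiles never have to be analysed.\<close>

definition jump :: "complex \<Rightarrow> real \<Rightarrow> complex set \<Rightarrow> real \<Rightarrow> real" where
  "jump u t S s = of_bool (near 1 u t S s) - of_bool (near (-1) u t S s)"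

lemma parallel_eq:
  assumes "norm u = 1" "Im (cnj v * u) = 0"
  shows "v = of_real (Re (cnj u * v)) * u"
proof -
  have 1: "u * cnj u = 1" using assms(1) complex_norm_square[of u] by simp
  have "Im (cnj u * v) = 0" using assms(2) by (simp add: algebra_simps)
  then have "cnj u * v = of_real (Re (cnj u * v))" by (simp add: complex_eq_iff)
  then have "u * cnj u * v = u * of_real (Re (cnj u * v))" by (metis mult.assoc)
  then show ?thesis using 1 by (simp add: mult.commute)
qed

lemma frame_coords:
  assumes "norm u = 1"
  shows "u * Complex (Re (cnj u * P)) (Im (cnj u * P)) = P"
proof -
  have 1: "u * cnj u = 1" using assms complex_norm_square[of u] by simp
  then show ?thesis by (simp add: mult.assoc[symmetric] del: times_complex.sel)
qed

lemma has_integral_open_interval: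
  fixes p q k :: real
  assumes "p \<le> q"
  shows "((\<lambda>s. if p < s \<and> s < q then k else 0) has_integral (k * (q - p))) UNIV"
proof -
  have "((\<lambda>s. k) has_integral (k * (q - p))) {p..q}"
    using has_integral_const_real[of k p q] assms by (simp add: mult.commute)
  then have "((\<lambda>s. if s \<in> {p..q} then k else 0) has_integral (k * (q - p))) UNIV"
    by (simp only: has_integral_restrict_UNIV)
  then show ?thesis
    by (rule has_integral_spike_finite[of "{p, q}", rotated 2]) auto
qed

text \<open>If no edge lies on the line, both sides agree at almost every point.  If an edge lies on it,
  the triangle is on one side only, and exactly along that edge.\<close>

lemma jump_has_integral_on_edge:
  assumes o: "lft A B C > 0" and u: "norm u = 1"
    and par: "Im (cnj (B - A) * u) = 0" and t: "Im (cnj u * A) = t"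
  shows "(jump u t (convex hull {A, B, C}) has_integral
    (edge_weight u t A B + edge_weight u t B C + edge_weight u t C A)) UNIV"
proof -
  define r where "r = Re (cnj u * (B - A))"
  have BA: "B - A = of_real r * u" using parallel_eq[OF u par] unfolding r_def .
  define sA where "sA = Re (cnj u * A)"
  have A: "A = u * Complex sA t" using frame_coords[OF u, of A] t sA_def by simp
  have B: "B = u * Complex (sA + r) t"
    using BA A by (simp add: complex_eq_iff algebra_simps)
  have nz: "r \<noteq> 0" using o BA by (auto simp: lft_def)
  \<comment> \<open>On the line through \<open>A\<close> and \<open>B\<close> the other two edge
    functions are affine in \<open>s\<close> and vanish at the end points \<open>sA + r\<close> and
    \<open>sA\<close>; the factor \<open>r\<close> avoids a division.\<close>
  have eqs: "lft A B (u * Complex s t) = 0"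
    "r * lft B C (u * Complex s t) = (sA + r - s) * lft A B C"
    "r * lft C A (u * Complex s t) = (s - sA) * lft A B C"
    "Re (cnj (B - A) * u) = r" for s
  proof -
    show "lft A B (u * Complex s t) = 0" "r * lft B C (u * Complex s t) = (sA + r - s) * lft A B C"
      "r * lft C A (u * Complex s t) = (s - sA) * lft A B C"
      unfolding A B by (simp_all add: lft_def algebra_simps)
    show "Re (cnj (B - A) * u) = r" by (simp add: r_def algebra_simps)
  qed
  have nonpar: "Im (cnj (C - B) * u) \<noteq> 0" "Im (cnj (A - C) * u) \<noteq> 0"
  proof -
    have "r * Im (cnj (C - B) * u) = - lft A B C" "r * Im (cnj (A - C) * u) = lft A B C"
      unfolding A B by (simp_all add: lft_def algebra_simps)
    then show "Im (cnj (C - B) * u) \<noteq> 0" "Im (cnj (A - C) * u) \<noteq> 0" using o by auto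
  qed
  have w: "edge_weight u t A B + edge_weight u t B C + edge_weight u t C A = r"
    using nonpar par t by (simp add: edge_weight_def r_def del: times_complex.sel)
  have pos: "(lft B C (u * Complex s t) > 0 \<longleftrightarrow> (sA + r - s) / r > 0) \<and>
     (lft C A (u * Complex s t) > 0 \<longleftrightarrow> (s - sA) / r > 0) \<and>
     (lft B C (u * Complex s t) = 0 \<longleftrightarrow> s = sA + r) \<and> (lft C A (u * Complex s t) = 0 \<longleftrightarrow> s = sA)" for s
  proof -
    have 1: "lft B C (u * Complex s t) = (sA + r - s) / r * lft A B C"
      "lft C A (u * Complex s t) = (s - sA) / r * lft A B C"
      using eqs(2,3)[of s] nz by (simp_all add: field_simps)
    show ?thesis unfolding 1 using o nz by (auto simp: zero_less_mult_iff simp del: times_divide_eq_left)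
  qed
  have near: "near d u t (convex hull {A, B, C}) s \<longleftrightarrow>
      d * r \<ge> 0 \<and> (sA + r - s) / r > 0 \<and> (s - sA) / r > 0" if "s \<notin> {sA, sA + r}" for s d
    unfolding near_iff_ahead[OF o] ahead_def using pos[of s] eqs(1)[of s] eqs(4) that by simp
  \<comment> \<open>The triangle lies above the line for \<open>r > 0\<close> and below it for
    \<open>r < 0\<close>, so the jump along the edge is \<open>1\<close> or \<open>- 1\<close> and
    the integral is \<open>r\<close> in both cases.\<close>
  consider "r > 0" | "r < 0" using nz by linarith
  then show ?thesis
  proof cases
    case 1
    have "((\<lambda>s. if sA < s \<and> s < sA + r then 1 else 0) has_integral 1 * (sA + r - sA)) UNIV"
      using 1 by (intro has_integral_open_interval) simp
    then have "(jump u t (convex hull {A, B, C}) has_integral 1 * (sA + r - sA)) UNIV"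
      by (rule has_integral_spike_finite[of "{sA, sA + r}", rotated 2])
         (use 1 in \<open>auto simp: jump_def near zero_less_divide_iff\<close>)
    then show ?thesis unfolding w by simp
  next
    case 2
    have "((\<lambda>s. if sA + r < s \<and> s < sA then - 1 else 0) has_integral (-1) * (sA - (sA + r))) UNIV"
      using 2 by (intro has_integral_open_interval) simp
    then have "(jump u t (convex hull {A, B, C}) has_integral (-1) * (sA - (sA + r))) UNIV"
      by (rule has_integral_spike_finite[of "{sA, sA + r}", rotated 2])
         (use 2 in \<open>auto simp: jump_def near zero_less_divide_iff\<close>)
    then show ?thesis unfolding w by simp
  qed
qed

lemma jump_has_integral:
  assumes o: "lft A B C > 0" and u: "norm u = 1"
  shows "(jump u t (convex hull {A, B, C}) has_integral
    (edge_weight u t A B + edge_weight u t B C + edge_weight u t C A)) UNIV"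
proof -
  let ?on = "\<lambda>P Q. Im (cnj (Q - P) * u) = 0 \<and> Im (cnj u * P) = t"
  have o': "lft B C A > 0" "lft C A B > 0"
    using o lft_cyclic[of A B C] lft_cyclic[of B C A] by auto
  have perm: "{B, C, A} = {A, B, C}" "{C, A, B} = {A, B, C}" by auto
  consider "?on A B" | "?on B C" | "?on C A" | "\<not> ?on A B" "\<not> ?on B C" "\<not> ?on C A" by blast
  then show ?thesis
  proof cases
    case 1
    then show ?thesis using jump_has_integral_on_edge[OF o u] by blast
  next
    case 2
    then show ?thesis using jump_has_integral_on_edge[OF o'(1) u, of t] by (simp add: perm add_ac)
  next
    case 3
    then show ?thesis using jump_has_integral_on_edge[OF o'(2) u, of t] by (simp add: perm add_ac)
  next
    case 4
    \<comment> \<open>If the edge function vanishes at a generic point, the edge is parallel to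
      \<open>u\<close>; then \<open>r * (t - tP) = 0\<close> puts the edge on the line, against the
      case assumption.\<close>
    have nz: "lft P Q (u * Complex s t) \<noteq> 0"
      if "\<not> ?on P Q" "edge_generic u t s P Q" "P \<noteq> Q" for P Q s
    proof
      assume z: "lft P Q (u * Complex s t) = 0"
      then have par: "Im (cnj (Q - P) * u) = 0" using that(2) by (simp add: edge_generic_def)
      define r where "r = Re (cnj u * (Q - P))"
      have QP: "Q - P = of_real r * u" using parallel_eq[OF u par] unfolding r_def .
      have "r \<noteq> 0" using QP that(3) by auto
      define sP tP where "sP = Re (cnj u * P)" and "tP = Im (cnj u * P)"
      have P: "P = u * Complex sP tP" using frame_coords[OF u, of P] by (simp add: sP_def tP_def)
      have "lft P Q (u * Complex s t) = Im (cnj (of_real r * u) * (u * Complex s t - u * Complex sP tP))"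
        unfolding P[symmetric] lft_def QP ..
      also have "\<dots> = r * (norm u)\<^sup>2 * (t - tP)"
        unfolding cmod_power2 by (simp add: algebra_simps power2_eq_square)
      finally have "t = tP" using z \<open>r \<noteq> 0\<close> u by simp
      then show False using that(1) par by (simp add: tP_def)
    qed
    have ne: "A \<noteq> B" "B \<noteq> C" "C \<noteq> A"
      using o by auto
    have "((\<lambda>s. 0) has_integral 0) (UNIV :: real set)" by simp
    then have "(jump u t (convex hull {A, B, C}) has_integral 0) UNIV"
    proof (rule has_integral_spike_finite[OF finite_not_generic[of u t "(A, B, C)"], rotated])
      fix s assume "s \<in> UNIV - {s. \<not> generic u t (A, B, C) s}"
      then have "lft A B (u * Complex s t) \<noteq> 0" "lft B C (u * Complex s t) \<noteq> 0" "lft C A (u * Complex s t) \<noteq> 0"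
        using nz[OF 4(1), of s] nz[OF 4(2), of s] nz[OF 4(3), of s] ne by (auto simp: generic_def)
      then show "jump u t (convex hull {A, B, C}) s = 0"
        by (simp add: jump_def near_iff_ahead[OF o] ahead_def)
    qed
    then show ?thesis
      unfolding edge_weight_def if_not_P[OF 4(1)] if_not_P[OF 4(2)] if_not_P[OF 4(3)] by simp
  qed
qed

subsection \<open>Additivity of homogeneous edge functions\<close>

definition orient :: "complex \<times> complex \<times> complex \<Rightarrow> real" where
  "orient = (\<lambda>(A, B, C). lft A B C)"

definition hull3 :: "complex \<times> complex \<times> complex \<Rightarrow> complex set" where
  "hull3 = (\<lambda>(A, B, C). convex hull {A, B, C})"

definition edge_sum :: "(complex \<Rightarrow> complex \<Rightarrow> real) \<Rightarrow> complex \<times> complex \<times> complex \<Rightarrow> real" where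
  "edge_sum f = (\<lambda>(A, B, C). f A B + f B C + f C A)"

definition verts :: "complex \<times> complex \<times> complex \<Rightarrow> complex set" where
  "verts = (\<lambda>(A, B, C). {A, B, C})"

lemma finite_verts [simp]: "finite (verts p)"
  by (cases p) (simp add: verts_def)

lemma edge_sum_sum: "(\<Sum>k\<in>K. edge_sum (f k) p) = edge_sum (\<lambda>P Q. \<Sum>k\<in>K. f k P Q) p"
  by (cases p) (simp add: edge_sum_def sum.distrib)

lemma edge_sum_mult: "c * edge_sum f p = edge_sum (\<lambda>P Q. c * f P Q) p"
  by (cases p) (simp add: edge_sum_def distrib_left)

lemma edge_sum_cong:
  assumes "orient p > 0" "\<And>P Q. P \<in> verts p \<Longrightarrow> Q \<in> verts p \<Longrightarrow> P \<noteq> Q \<Longrightarrow> f P Q = g P Q"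
  shows "edge_sum f p = edge_sum g p"
proof (cases p)
  case (fields A B C)
  then have "A \<noteq> B" "B \<noteq> C" "C \<noteq> A" using assms(1) by (auto simp: orient_def)
  then show ?thesis using assms(2) by (simp add: fields edge_sum_def verts_def)
qed

text \<open>At a generic point at most one tile is near on the side \<open>d\<close>, since two
  would share interior points. If none is near, the points beside the line avoid all of the finitely
  many tiles and hence \<open>E\<close>.\<close>

lemma of_bool_near_sum:
  assumes "finite I" and v: "\<And>i. i \<in> I \<Longrightarrow> orient (v i) > 0"
    and disj: "\<And>i j. i \<in> I \<Longrightarrow> j \<in> I \<Longrightarrow> i \<noteq> j \<Longrightarrow> interior (hull3 (v i)) \<inter> interior (hull3 (v j)) = {}"
    and U: "(\<Union>i\<in>I. hull3 (v i)) = E"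
    and u: "u \<noteq> 0" "d \<noteq> 0" and gen: "\<And>i. i \<in> I \<Longrightarrow> generic u t (v i) s"
  shows "of_bool (near d u t E s) = (\<Sum>i\<in>I. of_bool (near d u t (hull3 (v i)) s) :: real)"
proof (cases "\<exists>i\<in>I. near d u t (hull3 (v i)) s")
  case True
  then obtain i where i: "i \<in> I" "near d u t (hull3 (v i)) s" by blast
  have "\<not> near d u t (hull3 (v j)) s" if j: "j \<in> I" "j \<noteq> i" for j
  proof
    assume n: "near d u t (hull3 (v j)) s"
    have int: "eventually (\<lambda>\<epsilon>. u * Complex s (t + d * \<epsilon>) \<in> interior (hull3 (v k))) (at_right 0)"
      if "k \<in> I" "near d u t (hull3 (v k)) s" for k
      using near_interior[of "fst (v k)" "fst (snd (v k))" "snd (snd (v k))" u d t s]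
        v[OF that(1)] gen[OF that(1)] that(2) u
      by (simp add: hull3_def orient_def split_beta)
    have "eventually (\<lambda>\<epsilon>::real. False) (at_right 0)"
      using int[OF i] int[OF j(1) n]
      by eventually_elim (use disj[OF i(1) j(1)] j(2) in blast)
    then show False by simp
  qed
  then have "(\<Sum>j\<in>I. of_bool (near d u t (hull3 (v j)) s) :: real) = (\<Sum>j\<in>I. if j = i then 1 else 0)"
    by (intro sum.cong) (use i in auto)
  also have "\<dots> = 1" using i(1) \<open>finite I\<close> by simp
  also have "near d u t E s"
    using i unfolding near_def U[symmetric] by (auto elim: eventually_mono)
  ultimately show ?thesis by simp
next
  case False
  have "eventually (\<lambda>\<epsilon>. u * Complex s (t + d * \<epsilon>) \<notin> hull3 (v i)) (at_right 0)" if "i \<in> I" for i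
    using not_near_eventually[of "fst (v i)" "fst (snd (v i))" "snd (snd (v i))" d u t s]
        v[OF that] that False
    by (auto simp add: hull3_def orient_def split_beta)
  then have "eventually (\<lambda>\<epsilon>. \<forall>i\<in>I. u * Complex s (t + d * \<epsilon>) \<notin> hull3 (v i)) (at_right 0)"
    using \<open>finite I\<close> by (intro eventually_ball_finite) auto
  then have "eventually (\<lambda>\<epsilon>. u * Complex s (t + d * \<epsilon>) \<notin> E) (at_right 0)"
    unfolding U[symmetric] by (auto elim: eventually_mono)
  moreover have "\<not> near d u t E s"
  proof
    assume "near d u t E s"
    then have "eventually (\<lambda>\<epsilon>. u * Complex s (t + d * \<epsilon>) \<in> E) (at_right 0)"
      by (simp add: near_def)
    with calculation have "eventually (\<lambda>\<epsilon>::real. False) (at_right 0)"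
      by eventually_elim blast
    then show False by simp
  qed
  ultimately show ?thesis using False by simp
qed

text \<open>The index set lets each tile, given as a region of the plane, carry a chosen
  counterclockwise order of its vertices.\<close>

locale dissection =
  fixes I :: "'i set" and v :: "'i \<Rightarrow> complex \<times> complex \<times> complex" and e :: "complex \<times> complex \<times> complex"
  assumes finite: "finite I"
    and tile_ccw: "i \<in> I \<Longrightarrow> orient (v i) > 0"
    and disjoint: "i \<in> I \<Longrightarrow> j \<in> I \<Longrightarrow> i \<noteq> j \<Longrightarrow> interior (hull3 (v i)) \<inter> interior (hull3 (v j)) = {}"
    and cover: "(\<Union>i\<in>I. hull3 (v i)) = hull3 e"
    and ccw: "orient e > 0"
begin

text \<open>Additivity of the indicators of both sides makes the jumps additive off a finite set;
  integrating along the line turns this into additivity of the weights.\<close>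

lemma edge_weight_additive:
  assumes u: "norm u = 1"
  shows "(\<Sum>i\<in>I. edge_sum (edge_weight u t) (v i)) = edge_sum (edge_weight u t) e"
proof -
  have int: "(jump u t (hull3 p) has_integral edge_sum (edge_weight u t) p) UNIV" if "orient p > 0" for p
    using that jump_has_integral[OF _ u] by (cases p) (simp add: orient_def hull3_def edge_sum_def)
  have nz: "u \<noteq> 0" using u by auto
  have "((\<lambda>s. \<Sum>i\<in>I. jump u t (hull3 (v i)) s) has_integral
      (\<Sum>i\<in>I. edge_sum (edge_weight u t) (v i))) UNIV"
    using finite tile_ccw by (intro has_integral_sum int) auto
  then have "(jump u t (hull3 e) has_integral (\<Sum>i\<in>I. edge_sum (edge_weight u t) (v i))) UNIV"
  proof (rule has_integral_spike_finite[rotated 2])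
    show "finite (\<Union>i\<in>I. {s. \<not> generic u t (v i) s})"
      using finite finite_not_generic by auto
    fix s assume "s \<in> UNIV - (\<Union>i\<in>I. {s. \<not> generic u t (v i) s})"
    then have gen: "\<And>i. i \<in> I \<Longrightarrow> generic u t (v i) s" by auto
    have "of_bool (near d u t (hull3 e) s) = (\<Sum>i\<in>I. of_bool (near d u t (hull3 (v i)) s) :: real)"
      if "d \<noteq> 0" for d
      by (rule of_bool_near_sum[OF finite tile_ccw disjoint cover nz that gen])
    then show "jump u t (hull3 e) s = (\<Sum>i\<in>I. jump u t (hull3 (v i)) s)"
      by (simp add: jump_def sum_subtractf)
  qed
  then show ?thesis using int[OF ccw] has_integral_unique by blast
qed

definition all_verts :: "complex set" where
  "all_verts = verts e \<union> (\<Union>i\<in>I. verts (v i))"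

lemma finite_all_verts: "finite all_verts"
  using finite by (simp add: all_verts_def)

text \<open>An edge parallel to \<open>u\<close> lies on exactly one line of that direction, so
  summing over the finitely many heights of vertices counts it once.\<close>

lemma direction_weight_additive:
  assumes u: "norm u = 1"
  defines "w \<equiv> \<lambda>P Q. if Im (cnj (Q - P) * u) = 0 then Re (cnj u * (Q - P)) else 0"
  shows "(\<Sum>i\<in>I. edge_sum w (v i)) = edge_sum w e"
proof -
  define H where "H = (\<lambda>P. Im (cnj u * P)) ` all_verts"
  have "finite H" using finite_all_verts by (simp add: H_def)
  have w: "(\<Sum>t\<in>H. edge_weight u t P Q) = w P Q" if "P \<in> all_verts" for P Q
  proof -
    have "(\<Sum>t\<in>H. edge_weight u t P Q) = (\<Sum>t\<in>H. if t = Im (cnj u * P) then w P Q else 0)"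
      by (intro sum.cong) (auto simp: edge_weight_def w_def simp del: times_complex.sel)
    also have "\<dots> = w P Q" using \<open>finite H\<close> that by (simp add: H_def del: times_complex.sel)
    finally show ?thesis .
  qed
  have *: "(\<Sum>t\<in>H. edge_sum (edge_weight u t) p) = edge_sum w p" if "orient p > 0" "verts p \<subseteq> all_verts" for p
    unfolding edge_sum_sum using that(2) by (intro edge_sum_cong that w) auto
  have "(\<Sum>i\<in>I. edge_sum w (v i)) = (\<Sum>i\<in>I. \<Sum>t\<in>H. edge_sum (edge_weight u t) (v i))"
    by (intro sum.cong *[symmetric] tile_ccw) (auto simp: all_verts_def)
  also have "\<dots> = (\<Sum>t\<in>H. \<Sum>i\<in>I. edge_sum (edge_weight u t) (v i))" by (rule sum.swap)
  also have "\<dots> = (\<Sum>t\<in>H. edge_sum (edge_weight u t) e)" by (simp add: edge_weight_additive[OF u])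
  also have "\<dots> = edge_sum w e" by (intro * ccw) (auto simp: all_verts_def)
  finally show ?thesis .
qed

text \<open>On the finitely many edge directions that occur, \<psi> is a linear combination of
  direction weights, the coefficients being half its values at unit vectors.\<close>

theorem homogeneous_additive:
  fixes \<psi> :: "complex \<Rightarrow> real"
  assumes \<psi>: "\<And>r x. \<psi> (of_real r * x) = r * \<psi> x"
  shows "(\<Sum>i\<in>I. edge_sum (\<lambda>P Q. \<psi> (Q - P)) (v i)) = edge_sum (\<lambda>P Q. \<psi> (Q - P)) e"
proof -
  \<comment> \<open>\<open>D\<close> contains both unit vectors of each edge direction, hence the factor \<open>1/2\<close> below.\<close>
  define D where "D = (\<lambda>(P, Q). sgn (Q - P)) ` {(P, Q) \<in> all_verts \<times> all_verts. P \<noteq> Q}"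
  have "finite D" unfolding D_def
    by (intro finite_imageI finite_subset[OF _ finite_cartesian_product[OF finite_all_verts finite_all_verts]]) auto
  have D_norm: "norm u = 1" if "u \<in> D" for u
    using that by (auto simp: D_def norm_sgn)
  define w where "w = (\<lambda>u P Q. if Im (cnj (Q - P) * u) = 0 then Re (cnj u * (Q - P)) else 0)"
  \<comment> \<open>Only the unit vectors \<open>q\<close> and \<open>- q\<close> along the edge
    contribute. Both \<psi> and \<open>w\<close> change sign between them, so the two terms are
    equal halves.\<close>
  have part: "(\<Sum>u\<in>D. 1/2 * \<psi> u * w u P Q) = \<psi> (Q - P)"
    if "P \<in> all_verts" "Q \<in> all_verts" "P \<noteq> Q" for P Q
  proof -
    define x where "x = Q - P"
    have x: "x \<noteq> 0" using that x_def by simp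
    define q where "q = sgn x"
    have "norm q = 1" using x by (simp add: q_def norm_sgn)
    moreover have "x = of_real (norm x) * q"
      using x by (simp add: q_def sgn_div_norm scaleR_conv_of_real)
    ultimately have q: "norm q = 1" "x = of_real (norm x) * q" by blast+
    have "q = sgn (Q - P)" "- q = sgn (P - Q)"
      by (simp_all add: q_def x_def sgn_minus[symmetric])
    then have qD: "{q, - q} \<subseteq> D" using that by (force simp: D_def)
    have qq: "cnj q * q = 1" using q(1) complex_norm_square[of q] by (simp add: mult.commute)
    have "(\<Sum>u\<in>D. 1/2 * \<psi> u * w u P Q) = (\<Sum>u\<in>{q, - q}. 1/2 * \<psi> u * w u P Q)"
    proof (rule sum.mono_neutral_right[OF \<open>finite D\<close> qD], intro ballI)
      fix u assume u: "u \<in> D - {q, - q}"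
      have "Im (cnj (Q - P) * u) \<noteq> 0"
      proof
        assume z: "Im (cnj (Q - P) * u) = 0"
        have "x = of_real (Re (cnj u * x)) * u"
          using parallel_eq[of u x] z u D_norm by (simp add: x_def del: times_complex.sel)
        moreover define r where "r = Re (cnj u * x)"
        ultimately have xr: "x = of_real r * u" by simp
        have "norm x = \<bar>r\<bar>" using u D_norm by (simp add: xr norm_mult)
        then have "q = of_real (r / \<bar>r\<bar>) * u" using xr by (simp add: q_def sgn_div_norm scaleR_conv_of_real divide_inverse mult_ac)
        moreover have "r \<noteq> 0" using x xr by auto
        ultimately have "q = u \<or> q = - u" by (cases "r > 0") auto
        then show False using u by auto
      qed
      then show "1/2 * \<psi> u * w u P Q = 0" by (simp add: w_def del: times_complex.sel)
    qed
    also have "\<dots> = 1/2 * \<psi> q * w q P Q + 1/2 * \<psi> (- q) * w (- q) P Q"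
    proof -
      have "q + q \<noteq> 0" using q(1) by (auto simp flip: mult_2)
      then have "q \<noteq> - q" by (metis add.left_inverse)
      then show ?thesis by simp
    qed
    also have "\<dots> = norm x * \<psi> q"
    proof -
      have "cnj x * q = of_real (norm x)" "cnj q * x = of_real (norm x)"
        using qq by (subst q(2), simp add: mult_ac)+
      then have "w q P Q = norm x" unfolding w_def x_def[symmetric] by (simp del: times_complex.sel)
      moreover have "w (- q) P Q = - w q P Q" unfolding w_def by simp
      moreover have "\<psi> (- q) = - \<psi> q" using \<psi>[of "-1" q] by simp
      ultimately show ?thesis by simp
    qed
    also have "\<dots> = \<psi> x" using \<psi>[of "norm x" q] q(2) by simp
    finally show ?thesis by (simp add: x_def)
  qed
  have *: "(\<Sum>u\<in>D. 1/2 * \<psi> u * edge_sum (w u) p) = edge_sum (\<lambda>P Q. \<psi> (Q - P)) p"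
    if "orient p > 0" "verts p \<subseteq> all_verts" for p
    unfolding edge_sum_mult edge_sum_sum using that(2) by (intro edge_sum_cong that part) auto
  have "(\<Sum>i\<in>I. edge_sum (\<lambda>P Q. \<psi> (Q - P)) (v i)) = (\<Sum>i\<in>I. \<Sum>u\<in>D. 1/2 * \<psi> u * edge_sum (w u) (v i))"
    by (intro sum.cong *[symmetric] tile_ccw) (auto simp: all_verts_def)
  also have "\<dots> = (\<Sum>u\<in>D. 1/2 * \<psi> u * (\<Sum>i\<in>I. edge_sum (w u) (v i)))"
    unfolding sum_distrib_left by (rule sum.swap)
  also have "\<dots> = (\<Sum>u\<in>D. 1/2 * \<psi> u * edge_sum (w u) e)"
    using direction_weight_additive D_norm by (simp add: w_def)
  also have "\<dots> = edge_sum (\<lambda>P Q. \<psi> (Q - P)) e" by (intro * ccw) (auto simp: all_verts_def)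
  finally show ?thesis .
qed

end

subsection \<open>A sign for each direction\<close>

definition direction_class :: "real \<Rightarrow> complex \<Rightarrow> bool \<Rightarrow> complex \<Rightarrow> bool" where
  "direction_class \<beta> w b x \<longleftrightarrow>
     (\<exists>k m :: int. x = w * cis (of_int k * \<beta> + of_int m * (pi / 3)) \<and> (even m \<longleftrightarrow> b))"

text \<open>The difference gives a value without uniqueness of the exponents \<open>k\<close> and
  \<open>m\<close>: it is \<open>0\<close> if both parities or neither represent the direction. The
  condition on \<beta> enters through \<open>colour_base\<close>.\<close>

definition colour :: "real \<Rightarrow> complex \<Rightarrow> complex \<Rightarrow> int" where
  "colour \<beta> w x = of_bool (direction_class \<beta> w True x) - of_bool (direction_class \<beta> w False x)"

definition coloured_length :: "real \<Rightarrow> complex \<Rightarrow> complex \<Rightarrow> real" where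
  "coloured_length \<beta> w x = norm x * of_int (colour \<beta> w (sgn x))"

lemma direction_class_shift:
  assumes "direction_class \<beta> w b x"
  shows "direction_class \<beta> w (even n \<longleftrightarrow> b) (cis (of_int l * \<beta> + of_int n * (pi / 3)) * x)"
proof -
  obtain k m where x: "x = w * cis (of_int k * \<beta> + of_int m * (pi / 3))" and "even m \<longleftrightarrow> b"
    using assms direction_class_def by auto
  have "cis (of_int l * \<beta> + of_int n * (pi / 3)) * x =
      w * cis (of_int (l + k) * \<beta> + of_int (n + m) * (pi / 3))"
    unfolding x by (simp add: cis_mult mult.left_commute[of _ w] mult.commute[of w] mult.assoc[symmetric] distrib_right add_ac
      del: times_divide_eq_right)
  moreover have "even (n + m) \<longleftrightarrow> (even n \<longleftrightarrow> b)" using \<open>even m \<longleftrightarrow> b\<close> by auto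
  ultimately show ?thesis unfolding direction_class_def by blast
qed

lemma direction_class_shift_iff:
  "direction_class \<beta> w b (cis (of_int l * \<beta> + of_int n * (pi / 3)) * x) \<longleftrightarrow>
    direction_class \<beta> w (even n \<longleftrightarrow> b) x"
proof
  assume "direction_class \<beta> w b (cis (of_int l * \<beta> + of_int n * (pi / 3)) * x)"
  from direction_class_shift[OF this, of "- n" "- l"]
  have "direction_class \<beta> w (even n \<longleftrightarrow> b)
      (cis (- (l * \<beta> + n * (pi / 3))) * cis (l * \<beta> + n * (pi / 3)) * x)"
    by (simp add: algebra_simps)
  then show "direction_class \<beta> w (even n \<longleftrightarrow> b) x" by (simp add: cis_mult)
next
  assume "direction_class \<beta> w (even n \<longleftrightarrow> b) x"
  from direction_class_shift[OF this, of n l]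
  show "direction_class \<beta> w b (cis (of_int l * \<beta> + of_int n * (pi / 3)) * x)"
    by (cases "even n") auto
qed

text \<open>A turn by \<beta> keeps both parity classes, and a turn by \<open>pi / 3\<close>
  exchanges them.\<close>

lemma colour_shift:
  "colour \<beta> w (cis (of_int l * \<beta> + of_int n * (pi / 3)) * x) = (if even n then 1 else - 1) * colour \<beta> w x"
  unfolding colour_def direction_class_shift_iff by auto

text \<open>A half turn is three turns by \<open>pi / 3\<close>, an odd number. This yields
  homogeneity for negative factors.\<close>

lemma colour_minus: "colour \<beta> w (- x) = - colour \<beta> w x"
  using colour_shift[of \<beta> w 0 3 x] by simp

lemma coloured_length_scale: "coloured_length \<beta> w (of_real r * x) = r * coloured_length \<beta> w x"
proof (cases r "0 :: real" rule: linorder_cases)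
  case less
  then have "sgn (of_real r * x) = - sgn x" by (simp add: sgn_mult sgn_of_real)
  then show ?thesis using less by (simp add: coloured_length_def norm_mult colour_minus)
next
  case greater
  then have "sgn (of_real r * x) = sgn x" by (simp add: sgn_mult sgn_of_real)
  then show ?thesis using greater by (simp add: coloured_length_def norm_mult)
qed (simp add: coloured_length_def)

lemma coloured_length_shift:
  "coloured_length \<beta> w (cis (of_int l * \<beta> + of_int n * (pi / 3)) * x) =
    (if even n then 1 else - 1) * coloured_length \<beta> w x"
  by (simp add: coloured_length_def sgn_mult norm_mult sgn_cis colour_shift del: times_divide_eq_right)

lemma coloured_length_turn:
  "coloured_length \<beta> w (cis \<beta> * x) = coloured_length \<beta> w x"
  "coloured_length \<beta> w (cis (- \<beta>) * x) = coloured_length \<beta> w x"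
  "coloured_length \<beta> w (cis (pi / 3) * x) = - coloured_length \<beta> w x"
  "coloured_length \<beta> w (cis (- (pi / 3)) * x) = - coloured_length \<beta> w x"
  using coloured_length_shift[of \<beta> w 1 0 x] coloured_length_shift[of \<beta> w "- 1" 0 x]
    coloured_length_shift[of \<beta> w 0 1 x] coloured_length_shift[of \<beta> w 0 "- 1" x] by simp_all

lemma coloured_length_minus: "coloured_length \<beta> w (- x) = - coloured_length \<beta> w x"
  using coloured_length_scale[of \<beta> w "- 1" x] by simp

text \<open>If an odd \<open>m\<close> also represented \<open>w\<close>, then
  \<open>k * \<beta>\<close> would equal \<open>(6 * n - m) * (pi / 3)\<close>: for
  \<open>k = 0\<close> this makes \<open>m\<close> even, otherwise it makes \<beta> a rational
  multiple of \<open>pi / 3\<close>.\<close>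

lemma colour_base:
  assumes irr: "\<forall>q\<in>\<rat>. \<beta> \<noteq> q * (pi / 3)" and "w \<noteq> 0"
  shows "colour \<beta> w w = 1"
proof -
  have "direction_class \<beta> w True w"
    unfolding direction_class_def by (rule exI[of _ 0], rule exI[of _ 0]) simp
  moreover have "\<not> direction_class \<beta> w False w"
  proof
    assume "direction_class \<beta> w False w"
    then obtain k m :: int where "w = w * cis (of_int k * \<beta> + of_int m * (pi / 3))" and m: "odd m"
      unfolding direction_class_def by auto
    then have "cis (of_int k * \<beta> + of_int m * (pi / 3)) = 1" using \<open>w \<noteq> 0\<close> by simp
    then have "cos (of_int k * \<beta> + of_int m * (pi / 3)) = 1" by (simp add: complex_eq_iff)
    then obtain n :: int where n: "of_int k * \<beta> + of_int m * (pi / 3) = of_int n * 2 * pi"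
      unfolding cos_one_2pi_int by auto
    then have eq: "of_int k * \<beta> = of_int (6 * n - m) * (pi / 3)" by (simp add: algebra_simps)
    show False
    proof (cases "k = 0")
      case True
      then have "6 * n - m = 0" using eq by simp
      then show False using m by presburger
    next
      case False
      then have "\<beta> = (of_int (6 * n - m) / of_int k) * (pi / 3)" using eq by (simp add: field_simps)
      moreover have "(of_int (6 * n - m) / of_int k :: real) \<in> \<rat>" by (intro Rats_divide) auto
      ultimately show False using irr by blast
    qed
  qed
  ultimately show ?thesis by (simp add: colour_def)
qed

section \<open>Contributions of single triangles\<close>

lemma cis_of_inner:
  fixes x y :: complex
  assumes "x \<noteq> 0" "inner y x = norm y * norm x * cos \<theta>"
  shows "y = of_real (norm y / norm x) * (cis \<theta> * x) \<or> y = of_real (norm y / norm x) * (cis (- \<theta>) * x)"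
proof (cases "y = 0")
  case False
  define z where "z = y / x * of_real (norm x / norm y)"
  have nz: "norm z = 1" using assms False by (simp add: z_def norm_mult norm_divide)
  have "inner y x = Re (y * cnj x)" by (simp add: inner_complex_def)
  also have "y * cnj x = z * of_real (norm y * norm x)"
    using assms(1) False complex_norm_square[of x] by (simp add: z_def field_simps power2_eq_square)
  also have "Re \<dots> = Re z * (norm y * norm x)" by simp
  finally have Re: "Re z = cos \<theta>" using assms False by simp
  have "(Im z)\<^sup>2 = (sin \<theta>)\<^sup>2"
    using nz Re by (simp add: cmod_def sin_squared_eq)
  then have "Im z = sin \<theta> \<or> Im z = - sin \<theta>" by (simp add: power2_eq_iff)
  then have "z = cis \<theta> \<or> z = cis (- \<theta>)" using Re by (auto simp: complex_eq_iff)
  moreover have "y = of_real (norm y / norm x) * (z * x)" using assms(1) False by (simp add: z_def)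
  ultimately show ?thesis by metis
qed simp

text \<open>An unoriented angle leaves the sense of the turn open, but both turns by \<beta> keep
  the colour and both turns by \<open>pi / 3\<close> reverse it. Hence reflected tiles need no
  separate treatment.\<close>

lemma coloured_length_angle:
  fixes x y :: complex
  assumes "x \<noteq> 0"
  shows "inner y x = norm y * norm x * cos \<beta> \<Longrightarrow>
      coloured_length \<beta> w y = norm y / norm x * coloured_length \<beta> w x"
    and "inner y x = norm y * norm x / 2 \<Longrightarrow>
      coloured_length \<beta> w y = - (norm y / norm x) * coloured_length \<beta> w x"
proof -
  assume "inner y x = norm y * norm x * cos \<beta>"
  from cis_of_inner[OF assms this] show "coloured_length \<beta> w y = norm y / norm x * coloured_length \<beta> w x"
    by (metis coloured_length_scale coloured_length_turn(1,2))
next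
  assume "inner y x = norm y * norm x / 2"
  then have "inner y x = norm y * norm x * cos (pi / 3)" by (simp add: cos_60)
  from cis_of_inner[OF assms this] 
  show "coloured_length \<beta> w y = - (norm y / norm x) * coloured_length \<beta> w x"
    by (metis coloured_length_scale coloured_length_turn(3,4) mult_minus_left mult_minus_right)
qed

text \<open>This is Lagrange's identity for the plane cross product; it turns an angle condition
  into nondegeneracy.\<close>

lemma lft_square: "(lft P Q R)\<^sup>2 = (norm (Q - P))\<^sup>2 * (norm (R - P))\<^sup>2 - (inner (Q - P) (R - P))\<^sup>2"
  unfolding lft_def cmod_power2 inner_complex_def by (simp add: algebra_simps power2_eq_square)

lemma lft_nonzero_60:
  assumes "P \<noteq> Q" "P \<noteq> R" "inner (Q - P) (R - P) = norm (Q - P) * norm (R - P) / 2"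
  shows "lft P Q R \<noteq> 0"
proof -
  have "(lft P Q R)\<^sup>2 = 3 / 4 * ((norm (Q - P))\<^sup>2 * (norm (R - P))\<^sup>2)"
    unfolding lft_square assms(3) by (simp add: power_mult_distrib power_divide)
  then show ?thesis using assms(1,2) by auto
qed

text \<open>The colour of \<open>C - B\<close> decides the others: the angle \<beta> at
  \<open>B\<close> gives it to \<open>A - B\<close>, and the angle \<open>pi / 3\<close> at
  \<open>C\<close> gives it to \<open>A - C\<close>, since \<open>B - C\<close> has the opposite
  colour. A circuit of the boundary traverses \<open>A - B\<close> against the other two, hence the
  minus sign.\<close>

lemma ccw_tile:
  fixes A B C :: complex
  assumes ne: "A \<noteq> C" "B \<noteq> C" "A \<noteq> B"
    and C: "inner (A - C) (B - C) = norm (A - C) * norm (B - C) / 2"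
    and B: "inner (A - B) (C - B) = norm (A - B) * norm (C - B) * cos \<beta>"
  shows "\<exists>p. orient p > 0 \<and> hull3 p = convex hull {A, B, C} \<and>
    (\<exists>m::int. edge_sum (\<lambda>P Q. coloured_length \<beta> w (Q - P)) p =
       of_int m * (norm (B - C) + norm (A - C) - norm (A - B)))"
proof -
  let ?a = "norm (B - C)" and ?b = "norm (A - C)" and ?c = "norm (A - B)"
  let ?\<psi> = "coloured_length \<beta> w"
  define m where "m = colour \<beta> w (sgn (C - B))"
  have a: "?a = norm (C - B)" by (rule norm_minus_commute)
  have 1: "?\<psi> (C - B) = of_int m * ?a" by (simp add: coloured_length_def m_def a)
  have 2: "?\<psi> (A - B) = of_int m * ?c"
    using coloured_length_angle(1)[OF _ B, of w] ne 1 a by simp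
  have 3: "?\<psi> (A - C) = of_int m * ?b"
    using coloured_length_angle(2)[OF _ C, of \<beta> w] ne 1 coloured_length_minus[of \<beta> w "C - B"] a by simp
  have neg: "?\<psi> (B - A) = - ?\<psi> (A - B)" "?\<psi> (C - A) = - ?\<psi> (A - C)" "?\<psi> (B - C) = - ?\<psi> (C - B)"
    using coloured_length_minus[of \<beta> w "A - B"] coloured_length_minus[of \<beta> w "A - C"]
      coloured_length_minus[of \<beta> w "C - B"] by simp_all
  have nz: "lft C A B \<noteq> 0" using lft_nonzero_60[of C A B] ne C by simp
  show ?thesis
  proof (cases "lft C A B > 0")
    case True
    have "edge_sum (\<lambda>P Q. ?\<psi> (Q - P)) (A, B, C) = of_int m * (?a + ?b - ?c)"
      using 1 2 3 neg by (simp add: edge_sum_def algebra_simps)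
    moreover have "orient (A, B, C) > 0" using True by (simp add: orient_def lft_cyclic)
    ultimately show ?thesis by (intro exI[of _ "(A, B, C)"]) (auto simp: hull3_def)
  next
    case False
    have "edge_sum (\<lambda>P Q. ?\<psi> (Q - P)) (A, C, B) = of_int (- m) * (?a + ?b - ?c)"
      using 1 2 3 neg by (simp add: edge_sum_def algebra_simps)
    moreover have "orient (A, C, B) > 0"
      using False nz lft_swap[of A C B] by (simp add: orient_def)
    ultimately show ?thesis
      by (intro exI[of _ "(A, C, B)"] conjI exI[of _ "- m"]) (auto simp: hull3_def insert_commute)
  qed
qed

text \<open>Taking \<open>w\<close> as the direction of a side gives that side the colour
  \<open>1\<close>. Each further side is reached by one turn through \<open>pi / 3\<close> and one
  reversal, two sign changes, so all three count positively.\<close>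

lemma ccw_equilateral:
  fixes A B C :: complex
  assumes irr: "\<forall>q\<in>\<rat>. \<beta> \<noteq> q * (pi / 3)"
    and X: "norm (A - B) = X" "norm (B - C) = X" "norm (C - A) = X" "X > 0"
  shows "\<exists>p w. orient p > 0 \<and> hull3 p = convex hull {A, B, C} \<and>
    edge_sum (\<lambda>P Q. coloured_length \<beta> w (Q - P)) p = 3 * X"
proof -
  have X': "norm (B - A) = X" "norm (C - B) = X" "norm (A - C) = X"
    using X norm_minus_commute by metis+
  have inn: "inner (Q - P) (R - P) = norm (Q - P) * norm (R - P) / 2"
    if "norm (Q - P) = X" "norm (R - P) = X" "norm (Q - R) = X" for P Q R :: complex
  proof -
    have "(norm ((Q - P) - (R - P)))\<^sup>2 = (norm (Q - P))\<^sup>2 + (norm (R - P))\<^sup>2 - 2 * inner (Q - P) (R - P)"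
      unfolding power2_norm_eq_inner by (simp add: inner_diff inner_commute)
    then show ?thesis using that by (simp add: power2_eq_square)
  qed
  have ne: "A \<noteq> B" "B \<noteq> C" "C \<noteq> A" using X by auto
  \<comment> \<open>Proved for arbitrary names, since either order of the vertices may be the
    counterclockwise one and \<open>w\<close> is taken from a side.\<close>
  have main: "edge_sum (\<lambda>P Q. coloured_length \<beta> (sgn (B - A)) (Q - P)) (A, B, C) = 3 * X"
    if "norm (B - A) = X" "norm (C - B) = X" "norm (A - C) = X" for A B C :: complex
  proof -
    let ?\<psi> = "coloured_length \<beta> (sgn (B - A))"
    have that': "norm (A - B) = X" "norm (B - C) = X" "norm (C - A) = X"
      using that norm_minus_commute by metis+
    have ne: "A \<noteq> B" "B \<noteq> C" "C \<noteq> A" using that X by auto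
    have "?\<psi> (B - A) = X" using colour_base[OF irr, of "sgn (B - A)"] ne that(1)
      by (simp add: coloured_length_def sgn_zero_iff)
    moreover have "?\<psi> (C - A) = - ?\<psi> (B - A)"
      using coloured_length_angle(2)[OF _ inn[of C A B], of \<beta> "sgn (B - A)"] ne X(4) that that' by simp
    moreover have "?\<psi> (C - B) = - ?\<psi> (A - B)"
      using coloured_length_angle(2)[OF _ inn[of C B A], of \<beta> "sgn (B - A)"] ne X(4) that that' by simp
    ultimately show ?thesis
      using coloured_length_minus[of \<beta> "sgn (B - A)" "A - B"]
        coloured_length_minus[of \<beta> "sgn (B - A)" "A - C"] by (simp add: edge_sum_def)
  qed
  have nz: "lft A B C \<noteq> 0"
    using lft_nonzero_60[of A B C] ne inn[of B A C] X X' by simp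
  show ?thesis
  proof (cases "lft A B C > 0")
    case True
    then show ?thesis using main[of B A C] X X'
      by (intro exI[of _ "(A, B, C)"]) (auto simp: hull3_def orient_def)
  next
    case False
    have "lft A C B > 0" using False nz lft_swap[of A C B] lft_cyclic[of C A B] by simp
    then show ?thesis using main[of C A B] X X'
      by (intro exI[of _ "(A, C, B)"]) (auto simp: hull3_def orient_def insert_commute)
  qed
qed

subsection \<open>Tilings of equilateral triangles\<close>

definition to_complex :: "real^2 \<Rightarrow> complex" where
  "to_complex x = Complex (x $ 1) (x $ 2)"

lemma linear_to_complex: "linear to_complex"
  by (rule linearI) (simp_all add: to_complex_def complex_eq_iff)

lemma to_complex_diff: "to_complex (x - y) = to_complex x - to_complex y"
  by (simp add: to_complex_def complex_eq_iff)

lemma inner_to_complex: "inner (to_complex x) (to_complex y) = inner x y"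
  by (simp add: to_complex_def inner_complex_def inner_vec_def sum_2)

lemma norm_to_complex: "norm (to_complex x) = norm x"
  by (simp add: norm_eq_sqrt_inner inner_to_complex)

lemma inj_to_complex: "inj to_complex"
  by (rule injI) (simp add: to_complex_def vec_eq_iff forall_2)

lemma interior_to_complex: "interior (to_complex ` S) \<subseteq> to_complex ` interior S"
proof
  fix z assume z: "z \<in> interior (to_complex ` S)"
  have "continuous_on UNIV to_complex"
    using linear_to_complex by (simp add: linear_continuous_on linear_linear)
  then have "open (to_complex -` interior (to_complex ` S))"
    by (simp add: open_vimage)
  moreover have "to_complex -` interior (to_complex ` S) \<subseteq> S"
    using interior_subset[of "to_complex ` S"] inj_to_complex by (auto dest: injD)
  ultimately have "to_complex -` interior (to_complex ` S) \<subseteq> interior S"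
    by (simp add: interior_maximal)
  moreover obtain x where "z = to_complex x" using z interior_subset by blast
  ultimately show "z \<in> to_complex ` interior S" using z by blast
qed

lemma inner_angle_at:
  assumes "A \<noteq> B" "C \<noteq> B"
  shows "inner (A - B) (C - B) = norm (A - B) * norm (C - B) * cos (angle_at A B C)"
proof -
  let ?q = "inner (A - B) (C - B) / (norm (A - B) * norm (C - B))"
  have "\<bar>?q\<bar> \<le> 1"
    using Cauchy_Schwarz_ineq2[of "A - B" "C - B"] assms by (simp add: abs_mult)
  then have "cos (angle_at A B C) = ?q" by (simp add: angle_at_def cos_arccos_abs)
  then show ?thesis using assms by simp
qed

text \<open>The area is half the product of two sides times the sine of \<open>pi / 3\<close>.
  Squares are compared because the coordinate formula contains an absolute value.\<close>

lemma content_triangle_60: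
  fixes A B C :: "real^2"
  assumes "inner (A - C) (B - C) = norm (A - C) * norm (B - C) / 2"
  shows "measure lborel (convex hull {A, B, C}) = sqrt 3 / 4 * (norm (A - C) * norm (B - C))"
proof -
  have "(measure lborel (convex hull {A, B, C}))\<^sup>2 =
      ((norm (A - C))\<^sup>2 * (norm (B - C))\<^sup>2 - (inner (A - C) (B - C))\<^sup>2) / 4"
    unfolding content_triangle power2_norm_eq_inner inner_vec_def sum_2
    by (simp add: power_divide) (simp add: algebra_simps power2_eq_square)
  also have "\<dots> = (sqrt 3 / 4 * (norm (A - C) * norm (B - C)))\<^sup>2"
    unfolding assms by (simp add: power_mult_distrib power_divide)
  finally show ?thesis by (rule power2_eq_imp_eq) auto
qed

text \<open>After subtracting \<open>f 0\<close>, a distance-preserving map is an orthogonal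
  transformation, so \<open>f\<close> is linear up to a translation.\<close>

lemma isometry_hull:
  fixes f :: "real^2 \<Rightarrow> real^2"
  assumes f: "\<forall>x y. dist (f x) (f y) = dist x y"
  shows "f ` (convex hull X) = convex hull (f ` X)"
    and "inner (f x - f z) (f y - f z) = inner (x - z) (y - z)"
proof -
  define g where "g x = f x - f 0" for x
  have "orthogonal_transformation g"
    unfolding orthogonal_transformation_isometry using f by (simp add: g_def dist_norm)
  then have g: "linear g" "\<And>x y. inner (g x) (g y) = inner x y"
    by (auto simp: orthogonal_transformation_def)
  have fg: "f = (\<lambda>x. f 0 + g x)" by (simp add: g_def)
  have "f ` (convex hull X) = (+) (f 0) ` (g ` (convex hull X))"
    by (subst fg) (simp add: image_image)
  also have "\<dots> = convex hull ((+) (f 0) ` (g ` X))"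
    by (simp add: convex_hull_linear_image[OF g(1)] convex_hull_translation)
  also have "(+) (f 0) ` (g ` X) = f ` X" by (subst (2) fg) (simp add: image_image)
  finally show "f ` (convex hull X) = convex hull (f ` X)" .
  have "f x - f z = g (x - z)" for x z
    using linear_diff[OF g(1), of x z] by (simp add: g_def)
  then show "inner (f x - f z) (f y - f z) = inner (x - z) (y - z)" using g(2) by simp
qed

text \<open>The first equation is additivity of the coloured length; the second compares areas,
  where tile and equilateral triangle share the factor \<open>sqrt 3 / 4\<close>.\<close>

lemma tiling_relations:
  fixes A B C :: "real^2"
  assumes nc: "\<not> collinear {A, B, C}"
    and \<beta>: "angle_at A B C = \<beta>" and \<gamma>: "angle_at A C B = pi / 3"
    and irr: "\<forall>q\<in>\<rat>. \<beta> \<noteq> q * (pi / 3)"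
    and E: "equilateral_triangle E" and tile: "can_tile N (convex hull {A, B, C}) E"
  obtains X :: real and m :: int where "X > 0"
    "3 * X = of_int m * (norm (B - C) + norm (A - C) - norm (A - B))"
    "X\<^sup>2 = of_nat N * (norm (A - C) * norm (B - C))"
proof -
  obtain P Q R where PQR: "\<not> collinear {P, Q, R}" "E = convex hull {P, Q, R}"
    "dist P Q = dist Q R" "dist Q R = dist R P"
    using E unfolding equilateral_triangle_def by blast
  define X where "X = dist P Q"
  have "P \<noteq> Q" using PQR(1) by auto
  then have "X > 0" by (simp add: X_def)
  have nX: "norm (P - Q) = X" "norm (Q - R) = X" "norm (R - P) = X"
    using PQR(3,4) by (simp_all add: X_def dist_norm)
  have neq: "A \<noteq> B" "B \<noteq> C" "A \<noteq> C" using nc by (auto simp: insert_commute)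
  have inn: "inner (A - C) (B - C) = norm (A - C) * norm (B - C) / 2"
    "inner (A - B) (C - B) = norm (A - B) * norm (C - B) * cos \<beta>"
    using inner_angle_at[of A C B] inner_angle_at[of A B C] neq \<beta> \<gamma> by (simp_all add: cos_60)
  let ?T = "convex hull {A, B, C}" and ?h = to_complex
  obtain \<T> where \<T>: "finite \<T>" "card \<T> = N" "\<And>S. S \<in> \<T> \<Longrightarrow> congruent_regions ?T S" "\<Union>\<T> = E"
    and disj: "pairwise (\<lambda>S S'. interior S \<inter> interior S' = {}) \<T>"
    using tile unfolding can_tile_def tiling_by_def by blast
  have tiles: "\<exists>A' B' C'. S = convex hull {A', B', C'} \<and>
      norm (A' - C') = norm (A - C) \<and> norm (B' - C') = norm (B - C) \<and> norm (A' - B') = norm (A - B) \<and>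
      inner (A' - C') (B' - C') = inner (A - C) (B - C) \<and> inner (A' - B') (C' - B') = inner (A - B) (C - B)"
    if "S \<in> \<T>" for S
  proof -
    obtain f :: "real^2 \<Rightarrow> real^2" where f: "\<forall>x y. dist (f x) (f y) = dist x y" "f ` ?T = S"
      using \<T>(3)[OF \<open>S \<in> \<T>\<close>] unfolding congruent_regions_def by blast
    show ?thesis
      by (intro exI[of _ "f A"] exI[of _ "f B"] exI[of _ "f C"])
         (use f in \<open>simp add: isometry_hull[OF f(1)] dist_norm flip: f(2)\<close>)
  qed

  have hull: "?h ` (convex hull {x, y, z}) = convex hull {?h x, ?h y, ?h z}" for x y z
    by (simp add: convex_hull_linear_image[OF linear_to_complex])
  \<comment> \<open>The equilateral triangle comes first, because its side fixes the
    \<open>w\<close> by which all tiles are coloured.\<close>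
  obtain e w where e: "orient e > 0" "hull3 e = ?h ` E"
    "edge_sum (\<lambda>P Q. coloured_length \<beta> w (Q - P)) e = 3 * X"
    using ccw_equilateral[OF irr, of "?h P" "?h Q" X "?h R"] nX \<open>X > 0\<close>
    unfolding PQR(2) hull to_complex_diff[symmetric] norm_to_complex by auto
  let ?s = "norm (B - C) + norm (A - C) - norm (A - B)"
  have "\<exists>p. orient p > 0 \<and> hull3 p = ?h ` S \<and>
      (\<exists>m::int. edge_sum (\<lambda>P Q. coloured_length \<beta> w (Q - P)) p = of_int m * ?s)"
    if S: "S \<in> \<T>" for S
  proof -
    obtain A' B' C' where *: "S = convex hull {A', B', C'}"
      "norm (A' - C') = norm (A - C)" "norm (B' - C') = norm (B - C)" "norm (A' - B') = norm (A - B)"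
      "inner (A' - C') (B' - C') = inner (A - C) (B - C)" "inner (A' - B') (C' - B') = inner (A - B) (C - B)"
      using tiles[OF S] by blast
    have "norm (C' - B') = norm (C - B)" using *(3) by (simp add: norm_minus_commute)
    moreover have "?h A' \<noteq> ?h C'" "?h B' \<noteq> ?h C'" "?h A' \<noteq> ?h B'"
      using *(2-4) neq inj_to_complex by (auto dest: injD)
    ultimately show ?thesis
      using ccw_tile[of "?h A'" "?h C'" "?h B'" \<beta> w] * inn
      unfolding *(1) hull by (simp add: to_complex_diff[symmetric] norm_to_complex inner_to_complex)
  qed
  then obtain v m where v: "\<And>S. S \<in> \<T> \<Longrightarrow> orient (v S) > 0" "\<And>S. S \<in> \<T> \<Longrightarrow> hull3 (v S) = ?h ` S"
    "\<And>S. S \<in> \<T> \<Longrightarrow> edge_sum (\<lambda>P Q. coloured_length \<beta> w (Q - P)) (v S) = of_int (m S :: int) * ?s"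
    by metis
  interpret dissection \<T> v e
  proof
    show "finite \<T>" "orient e > 0" by fact+
    show "orient (v S) > 0" if "S \<in> \<T>" for S using v(1) that .
    show "(\<Union>S\<in>\<T>. hull3 (v S)) = hull3 e" using v(2) \<T>(4) e(2) by auto
    fix S S' assume S: "S \<in> \<T>" "S' \<in> \<T>" "S \<noteq> S'"
    then have "interior S \<inter> interior S' = {}" using disj by (auto simp: pairwise_def)
    then show "interior (hull3 (v S)) \<inter> interior (hull3 (v S')) = {}"
      using interior_to_complex[of S] interior_to_complex[of S'] v(2)[OF S(1)] v(2)[OF S(2)]
        image_Int[OF inj_to_complex, of "interior S" "interior S'"] by auto
  qed
  have "3 * X = (\<Sum>S\<in>\<T>. of_int (m S) * ?s)"
    using homogeneous_additive[of "coloured_length \<beta> w", OF coloured_length_scale] e(3) v(3) by simp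
  then have 1: "3 * X = of_int (\<Sum>S\<in>\<T>. m S) * ?s" by (simp add: sum_distrib_right)

  have meas: "convex hull {x, y, z} \<in> lmeasurable"
      "measure lebesgue (convex hull {x, y, z}) = measure lborel (convex hull {x, y, z})" for x y z :: "real^2"
    using finite_imp_compact_convex_hull[of "{x, y, z}"]
    by (auto intro: lmeasurable_compact measure_completion dest: compact_imp_closed)
  have area: "measure lebesgue S = sqrt 3 / 4 * (norm (A - C) * norm (B - C))" and "S \<in> lmeasurable" "convex S"
    if S: "S \<in> \<T>" for S
  proof -
    obtain A' B' C' where *: "S = convex hull {A', B', C'}"
      "norm (A' - C') = norm (A - C)" "norm (B' - C') = norm (B - C)"
      "inner (A' - C') (B' - C') = inner (A - C) (B - C)"
      using tiles[OF S] by blast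
    show "measure lebesgue S = sqrt 3 / 4 * (norm (A - C) * norm (B - C))" "S \<in> lmeasurable" "convex S"
      using * content_triangle_60[of A' C' B'] inn meas by simp_all
  qed
  \<comment> \<open>The intersection of two tiles is convex with empty interior, hence a null set,
    so areas add up.\<close>
  have "pairwise (\<lambda>S S'. negligible (S \<inter> S')) \<T>"
    unfolding pairwise_def
  proof (intro ballI impI)
    fix S S' assume "S \<in> \<T>" "S' \<in> \<T>" "S \<noteq> S'"
    then show "negligible (S \<inter> S')"
      using disj \<open>\<And>S. S \<in> \<T> \<Longrightarrow> convex S\<close>
      by (subst negligible_convex_interior) (auto simp: pairwise_def intro: convex_Int)
  qed
  then have "measure lebesgue E = (\<Sum>S\<in>\<T>. measure lebesgue S)"
    unfolding \<T>(4)[symmetric] using \<T>(1) \<open>\<And>S. S \<in> \<T> \<Longrightarrow> S \<in> lmeasurable\<close>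
    by (rule measure_negligible_finite_Union[rotated 2])
  also have "\<dots> = of_nat N * (sqrt 3 / 4 * (norm (A - C) * norm (B - C)))"
    using \<T>(2) by (simp only: area sum_constant cong: sum.cong)
  also have "measure lebesgue E = sqrt 3 / 4 * (X * X)"
  proof -
    have "norm (P - R) = X" using nX(3) by (simp add: norm_minus_commute)
    moreover have "inner (P - R) (Q - R) = X * X / 2"
    proof -
      have "(norm ((P - R) - (Q - R)))\<^sup>2 = (norm (P - R))\<^sup>2 + (norm (Q - R))\<^sup>2 - 2 * inner (P - R) (Q - R)"
        unfolding power2_norm_eq_inner by (simp add: inner_diff inner_commute)
      then show ?thesis using nX \<open>norm (P - R) = X\<close> by (simp add: power2_eq_square)
    qed
    ultimately show ?thesis
      unfolding PQR(2) meas(2) using content_triangle_60[of P R Q] nX(2) by simp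
  qed
  finally have "sqrt 3 / 4 * X\<^sup>2 = sqrt 3 / 4 * (of_nat N * (norm (A - C) * norm (B - C)))"
    by (simp add: power2_eq_square mult_ac)
  then have 2: "X\<^sup>2 = of_nat N * (norm (A - C) * norm (B - C))" by simp
  show ?thesis using that[OF \<open>X > 0\<close> 1 2] .
qed

section \<open>Squarefree parts and the conclusion\<close>

lemma squarefree_part_mult_square:
  fixes n k :: nat
  assumes "k \<noteq> 0"
  shows "squarefree_part (n * k\<^sup>2) = squarefree_part n"
proof (cases "n = 0")
  case False
  \<comment> \<open>The multiplicity of a prime in the squarefree part is the parity of its
    multiplicity in the number, which a square factor does not change.\<close>
  have "normalize (squarefree_part (n * k\<^sup>2)) = normalize (squarefree_part n)"
  proof (rule multiplicity_eq_imp_eq)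
    fix p :: nat assume "prime p"
    then show "multiplicity p (squarefree_part (n * k\<^sup>2)) = multiplicity p (squarefree_part n)"
      using False assms
      by (simp add: prime_multiplicity_squarefree_part prime_elem_multiplicity_mult_distrib
          prime_elem_multiplicity_power_distrib)
  qed auto
  then show ?thesis by simp
qed simp

theorem theorem5:
  fixes T :: "(real^2) set" and \<alpha> \<beta> :: real and N K :: nat
  assumes "triangle_with_angles T \<alpha> \<beta> (pi / 3)"
    and "\<forall>q\<in>\<rat>. \<beta> \<noteq> q * (pi / 3)"
    and "\<exists>E. equilateral_triangle E \<and> can_tile N T E"
    and "\<exists>E. equilateral_triangle E \<and> can_tile K T E"
  shows "squarefree_part N = squarefree_part K"
proof -
  obtain A B C where T: "\<not> collinear {A, B, C}" "T = convex hull {A, B, C}"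
    "angle_at A B C = \<beta>" "angle_at A C B = pi / 3"
    using assms(1) unfolding triangle_with_angles_def by blast
  note relations = tiling_relations[OF T(1,3,4) assms(2), folded T(2)]
  define s ab where "s = norm (B - C) + norm (A - C) - norm (A - B)" and "ab = norm (A - C) * norm (B - C)"
  obtain X m where X: "X > 0" "3 * X = of_int m * s" "X\<^sup>2 = of_nat N * ab"
    using assms(3) relations unfolding s_def ab_def by metis
  obtain Y n where Y: "Y > 0" "3 * Y = of_int n * s" "Y\<^sup>2 = of_nat K * ab"
    using assms(4) relations unfolding s_def ab_def by metis
  \<comment> \<open>Positivity of \<open>X\<close> and \<open>Y\<close> excludes every zero factor,
    so \<open>ab\<close> can be cancelled and the squares below have nonzero bases.\<close>
  have nz: "m \<noteq> 0" "n \<noteq> 0" "s \<noteq> 0" "ab \<noteq> 0" using X Y by auto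
  \<comment> \<open>Cross multiplication eliminates the real number \<open>s\<close>.\<close>
  have "of_int n * (3 * X) = of_int m * (3 * Y)" unfolding X(2) Y(2) by simp
  then have "of_int n * X = of_int m * Y" by simp
  then have "(of_int n * X)\<^sup>2 = (of_int m * Y)\<^sup>2" by simp
  then have "(of_int n)\<^sup>2 * (of_nat N * ab) = (of_int m)\<^sup>2 * (of_nat K * ab)"
    unfolding power_mult_distrib X(3) Y(3) .
  then have "real N * (real_of_int n)\<^sup>2 = real K * (real_of_int m)\<^sup>2" using nz by (simp add: mult.commute)
  then have "real (N * (nat \<bar>n\<bar>)\<^sup>2) = real (K * (nat \<bar>m\<bar>)\<^sup>2)" by simp
  then have "N * (nat \<bar>n\<bar>)\<^sup>2 = K * (nat \<bar>m\<bar>)\<^sup>2" by (simp only: of_nat_eq_iff)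
  then show ?thesis
    using squarefree_part_mult_square[of "nat \<bar>n\<bar>" N] squarefree_part_mult_square[of "nat \<bar>m\<bar>" K] nz by simp
qed

end
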